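(* Let $n\ge2$ be an integer. For $x>0$ and $\lambda_1,\lambda_2\geq 0$ with $\lambda_1\ne\lambda_2$, $$\psi_{n,2}(x,\lambda_1,\lambda_2)=\frac{x^{2n-2}\,e^{-\lambda_1-\lambda_2-2x}}{n!\,(n-2)!\,(\lambda_1-\lambda_2)}\;\det\begin{pmatrix}{}_0F_1(n-1;x\lambda_1)&{}_0F_1(n-1;x\lambda_2)\\ G_{n,2}(x,\lambda_1)&G_{n,2}(x,\lambda_2)\end{pmatrix},$$ where $$G_{n,2}(x,y)=n\,{}_0F_1(n;xy)+y\,{}_0F_1(n+1;xy)+(x-y-n+1)\,e^{y}\int_y^\infty e^{-t}\,{}_0F_1(n+1;xt)\,dt .$$
   Context: For a positive integer $a$, ${}_0F_1(a;z)=\sum_{k=0}^\infty \frac{z^k}{(a)_k\,k!}$ with $(a)_k=a(a+1)\cdots(a+k-1)$. For integers $k\ge 0$, $a\ge1$, put $$H^k_a(x,y)=\int_0^x t^k e^{-t}\,{}_0F_1(a;ty)\,dt .$$ The function $\psi_{n,2}$ is the probability density function of the largest eigenvalue of a complex non-central Wishart matrix of size $2\times 2$ with $n$ degrees of freedom, identity covariance matrix, and non-centrality matrix with eigenvalues $\lambda_1,\lambda_2$. It is given, for $\lambda_1\neq\lambda_2$, by $$\psi_{n,2}(x,\lambda_1,\lambda_2)=\frac{e^{-\lambda_1-\lambda_2}}{\{(n-2)!\}^2\,(\lambda_1-\lambda_2)}\;\frac{\partial}{\partial x}\det\begin{pmatrix}H^{n-1}_{n-1}(x,\lambda_1)&H^{n-1}_{n-1}(x,\lambda_2)\\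 H^{n-2}_{n-1}(x,\lambda_1)&H^{n-2}_{n-1}(x,\lambda_2)\end{pmatrix},$$ which is taken as its definition here. *)

theory Defs
  imports "HOL-Analysis.Analysis"
begin

text \<open>Only ever used for \<open>a \<ge> 1\<close>, so that no denominator vanishes.\<close>

definition hyp0F1 :: "nat \<Rightarrow> real \<Rightarrow> real" where
  "hyp0F1 a z = (\<Sum>k. z ^ k / (pochhammer (real a) k * fact k))"

definition H :: "nat \<Rightarrow> nat \<Rightarrow> real \<Rightarrow> real \<Rightarrow> real" where
  "H k a x y = integral {0..x} (\<lambda>t. t ^ k * exp (- t) * hyp0F1 a (t * y))"

text \<open>
  The density of the largest eigenvalue of a complex non-central \<open>2 \<times> 2\<close> Wishart matrix with
  \<open>n\<close> degrees of freedom, identity covariance and non-centrality eigenvalues \<open>l1 \<noteq> l2\<close>; this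
  determinantal formula is taken as the definition. It is meaningful for \<open>n \<ge> 2\<close> (natural
  number subtraction) and \<open>l1 \<noteq> l2\<close> (division).
\<close>

definition psi2 :: "nat \<Rightarrow> real \<Rightarrow> real \<Rightarrow> real \<Rightarrow> real" where
  "psi2 n x l1 l2 =
     exp (- l1 - l2) / ((fact (n - 2))\<^sup>2 * (l1 - l2)) *
     deriv (\<lambda>u. det (vector
       [vector [H (n - 1) (n - 1) u l1, H (n - 1) (n - 1) u l2],
        vector [H (n - 2) (n - 1) u l1, H (n - 2) (n - 1) u l2]] :: real ^ 2 ^ 2)) x"

definition G2 :: "nat \<Rightarrow> real \<Rightarrow> real \<Rightarrow> real" where
  "G2 n x y =
     real n * hyp0F1 n (x * y) + y * hyp0F1 (n + 1) (x * y)
     + (x - y - real n + 1) * exp y *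
       integral {y..} (\<lambda>t. exp (- t) * hyp0F1 (n + 1) (x * t))"

end

theory Submission
  imports Defs
begin

text \<open>
  Write \<open>F a\<close> for \<open>hyp0F1 a\<close> and \<open>w\<close> for \<open>x ^ (n - 2) * exp (- x)\<close>. The two rows of the matrix in
  \<open>psi2\<close> are the integrals \<open>H (n - 1) (n - 1)\<close> and \<open>H (n - 2) (n - 1)\<close>, whose integrands at \<open>x\<close>
  differ by the factor \<open>x\<close> only. Hence the derivative of the determinant is
  \<open>w * (F (n - 1) (x l1) * D l2 - F (n - 1) (x l2) * D l1)\<close> with
  \<open>D y = x * H (n - 2) (n - 1) x y - H (n - 1) (n - 1) x y\<close>, and the theorem says that \<open>D y\<close> is
  \<open>x ^ n * exp (- x) / (n (n - 1)) * G2 n x y\<close> (\<open>H_combination_eq_G2\<close>).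

  Everything is expressed through the integrals \<open>K a = H (a - 1) a\<close>, in which the power of \<open>t\<close>
  matches the parameter. As \<open>t ^ a * F (a + 1) (t y)\<close> has derivative
  \<open>a * t ^ (a - 1) * F a (t y)\<close>, integration by parts gives a recurrence from \<open>K a\<close> to
  \<open>K (a + 1)\<close> (\<open>H_recurrence\<close>), and the contiguous relation of \<open>F\<close> writes
  \<open>H (n - 1) (n - 1)\<close> as a combination of \<open>K n\<close> and \<open>K (n + 1)\<close> (\<open>H_contiguous\<close>). So \<open>D y\<close>
  is a multiple of \<open>K n\<close> plus the two \<open>hyp0F1\<close> terms of \<open>G2\<close>.

  It remains to turn \<open>K n\<close>, an integral over \<open>t\<close> from \<open>0\<close> to \<open>x\<close>, into the integral over
  \<open>[y, \<infinity>)\<close> in \<open>G2\<close> (\<open>integral_Ici_exp_hyp0F1\<close>). Differentiation in \<open>y\<close> yields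
  \<open>K (n + 1) / n\<close>, so by the recurrence \<open>exp (- y) * K n\<close> is, up to a constant factor, an
  antiderivative of \<open>exp (- y) * F (n + 1) (x y)\<close>; it vanishes at infinity.
\<close>

section \<open>The confluent hypergeometric limit function\<close>

lemma fact_le_pochhammer:
  assumes "(1::real) \<le> a"
  shows "fact k \<le> pochhammer a k"
proof (induction k)
  case (Suc k)
  have "fact k * (1 + real k) \<le> pochhammer a k * (a + real k)"
    using assms order_trans[OF fact_ge_zero Suc] by (intro mult_mono Suc) auto
  then show ?case by (simp add: pochhammer_Suc algebra_simps)
qed simp

lemma one_le_pochhammer:
  assumes "(1::real) \<le> a"
  shows "1 \<le> pochhammer a k"
  using fact_le_pochhammer[OF assms, of k] fact_ge_1[of k, where 'a = real] by linarith

lemma summable_hyp0F1: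
  assumes "a > 0"
  shows "summable (\<lambda>k. z ^ k / (pochhammer (real a) k * fact k))"
proof (rule summable_comparison_test')
  show "summable (\<lambda>k. inverse (fact k) * \<bar>z\<bar> ^ k)"
    by (rule summable_exp)
  fix k :: nat
  have "1 \<le> pochhammer (real a) k"
    using assms by (intro one_le_pochhammer) simp
  then have "\<bar>z\<bar> ^ k / (pochhammer (real a) k * fact k) \<le> \<bar>z\<bar> ^ k / fact k"
    by (intro divide_left_mono) (auto simp: mult_le_cancel_right1)
  with \<open>1 \<le> pochhammer (real a) k\<close>
  show "norm (z ^ k / (pochhammer (real a) k * fact k)) \<le> inverse (fact k) * \<bar>z\<bar> ^ k"
    by (simp add: abs_mult power_abs divide_inverse mult.commute)
qed

lemma hyp0F1_sums:
  assumes "a > 0"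
  shows "(\<lambda>k. z ^ k / (pochhammer (real a) k * fact k)) sums hyp0F1 a z"
  unfolding hyp0F1_def using summable_hyp0F1[OF assms] by (rule summable_sums)

lemma DERIV_hyp0F1:
  assumes "a > 0"
  shows "(hyp0F1 a has_real_derivative hyp0F1 (Suc a) z / real a) (at z)"
proof -
  define c where "c k = 1 / (pochhammer (real a) k * fact k)" for k
  have "hyp0F1 a = (\<lambda>z. \<Sum>k. c k * z ^ k)"
    by (simp add: hyp0F1_def c_def fun_eq_iff)
  moreover have "((\<lambda>z. \<Sum>k. c k * z ^ k) has_real_derivative (\<Sum>k. diffs c k * z ^ k)) (at z)"
    using summable_hyp0F1[OF assms]
    by (intro termdiffs_strong_converges_everywhere) (simp add: c_def)
  moreover have "(\<Sum>k. diffs c k * z ^ k) = hyp0F1 (Suc a) z / real a"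
  proof -
    have "diffs c k * z ^ k = z ^ k / (pochhammer (real (Suc a)) k * fact k) / real a" for k
    proof -
      have "diffs c k = real (Suc k) / (real a * pochhammer (real (Suc a)) k * (real (Suc k) * fact k))"
        by (simp add: diffs_def c_def pochhammer_rec add.commute)
      also have "\<dots> = 1 / (real a * pochhammer (real (Suc a)) k * fact k)"
        by (simp del: of_nat_Suc)
      finally show ?thesis
        by (simp add: mult_ac)
    qed
    then show ?thesis
      using sums_divide[OF hyp0F1_sums[of "Suc a" z], of "real a"] by (simp add: sums_iff)
  qed
  ultimately show ?thesis by simp
qed

lemmas DERIV_hyp0F1_chain [derivative_intros] = DERIV_chain2[OF DERIV_hyp0F1]

lemma continuous_on_hyp0F1 [continuous_intros]:
  assumes "a > 0" "continuous_on S f"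
  shows "continuous_on S (\<lambda>x. hyp0F1 a (f x))"
proof -
  have "continuous_on UNIV (hyp0F1 a)"
    using DERIV_isCont[OF DERIV_hyp0F1[OF assms(1)]] by (auto simp: continuous_on_eq_continuous_at)
  then show ?thesis
    using assms(2) by (rule continuous_on_compose2) auto
qed

text \<open>
  The coefficients of the left side minus those of the first term on the right vanish at \<open>k = 0\<close>;
  shifted by one they are the coefficients of the last term.
\<close>

lemma hyp0F1_contiguous:
  assumes "a > 0"
  shows "hyp0F1 a z = hyp0F1 (a + 1) z + z / (real a * (real a + 1)) * hyp0F1 (a + 2) z"
proof -
  let ?d = "\<lambda>k. z ^ k / (pochhammer (real a) k * fact k) - z ^ k / (pochhammer (real (a + 1)) k * fact k)"
  have "?d (Suc k) = z / (real a * (real a + 1)) * (z ^ k / (pochhammer (real (a + 2)) k * fact k))" for k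
  proof -
    define p where "p = pochhammer (real a + 1) k"
    define q where "q = pochhammer (real a + 2) k"
    have p: "p > 0" unfolding p_def by (intro pochhammer_pos) simp
    have q: "q > 0" unfolding q_def by (intro pochhammer_pos) simp
    have pq: "p * (real a + 1 + real k) = (real a + 1) * q"
      using pochhammer_rec[of "real a + 1" k] pochhammer_Suc[of "real a + 1" k]
      by (simp add: p_def q_def add.assoc)
    have A: "pochhammer (real a) (Suc k) = real a * p"
      by (simp add: pochhammer_rec p_def)
    have B: "pochhammer (real a + 1) (Suc k) = (real a + 1) * q"
      by (simp add: pochhammer_rec q_def add.assoc)
    have "1 / (real a * p) - 1 / ((real a + 1) * q) = (real k + 1) / (real a * ((real a + 1) * q))"
    proof -
      have "1 / (real a * p) = (real a + 1 + real k) / (real a * ((real a + 1) * q))"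
      proof -
        have "r / (real a * (p * r)) = 1 / (real a * p)" if "r \<noteq> 0" for r
          using that by simp
        from this[of "real a + 1 + real k"] show ?thesis
          unfolding pq[symmetric] by simp
      qed
      moreover have "1 / ((real a + 1) * q) = real a / (real a * ((real a + 1) * q))"
        using assms by simp
      ultimately have "1 / (real a * p) - 1 / ((real a + 1) * q)
          = (real a + 1 + real k - real a) / (real a * ((real a + 1) * q))"
        by (simp only: diff_divide_distrib)
      then show ?thesis
        by (simp add: add.commute)
    qed
    then have "z ^ Suc k / fact (Suc k) * (1 / (real a * p) - 1 / ((real a + 1) * q))
      = z ^ Suc k / ((real k + 1) * fact k) * ((real k + 1) / (real a * ((real a + 1) * q)))"
      by (simp add: add.commute)
    also have "\<dots> = z / (real a * (real a + 1)) * (z ^ k / (q * fact k))"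
    proof -
      have "z * z ^ k / (r * f) * (r / (b * (d * q))) = z / (b * d) * (z ^ k / (q * f))"
        if "r \<noteq> 0" for r f b d :: real
        using that by (simp add: mult_ac)
      from this[of "real k + 1"] show ?thesis
        by simp
    qed
    finally show ?thesis
      using A B by (simp add: q_def diff_divide_distrib right_diff_distrib mult.commute add.commute)
  qed
  then have "(\<lambda>k. ?d (Suc k)) sums (z / (real a * (real a + 1)) * hyp0F1 (a + 2) z)"
    by (simp only: sums_mult[OF hyp0F1_sums] add_gr_0 zero_less_numeral simp_thms)
  then have "?d sums (z / (real a * (real a + 1)) * hyp0F1 (a + 2) z)"
    by (subst (asm) sums_Suc_iff) simp
  moreover have "?d sums (hyp0F1 a z - hyp0F1 (a + 1) z)"
    using assms by (intro sums_diff hyp0F1_sums) auto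
  ultimately show ?thesis
    using sums_unique2 by fastforce
qed

lemma hyp0F1_nonneg:
  assumes "a > 0" "0 \<le> z"
  shows "0 \<le> hyp0F1 a z"
  unfolding hyp0F1_def using assms summable_hyp0F1
  by (intro suminf_nonneg) (auto intro!: divide_nonneg_nonneg mult_nonneg_nonneg pochhammer_nonneg)

text \<open>
  Growth of arbitrarily small exponential type, from \<open>(1 / c) ^ k / k! \<le> exp (1 / c)\<close>. It replaces
  the sharp growth \<open>exp (2 * sqrt z)\<close>.
\<close>

lemma hyp0F1_le_exp:
  assumes "a > 0" "0 < c" "0 \<le> z"
  shows "hyp0F1 a z \<le> exp (1 / c) * exp (c * z)"
proof (rule sums_le)
  show "(\<lambda>k. z ^ k / (pochhammer (real a) k * fact k)) sums hyp0F1 a z"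
    using assms(1) by (rule hyp0F1_sums)
  show "(\<lambda>k. exp (1 / c) * ((c * z) ^ k /\<^sub>R fact k)) sums (exp (1 / c) * exp (c * z))"
    by (intro sums_mult exp_converges)
  fix k
  have "(1 / c) ^ k /\<^sub>R fact k \<le> exp (1 / c)"
    using sum_le_suminf[OF sums_summable[OF exp_converges[of "1 / c"]], of "{k}"] assms(2)
      sums_unique[OF exp_converges[of "1 / c"]] by simp
  also have "(1 / c) ^ k /\<^sub>R fact k = 1 / (c ^ k * fact k)"
    by (simp add: field_simps)
  finally have "1 / fact k \<le> exp (1 / c) * c ^ k"
    using assms(2) by (simp add: field_simps)
  moreover have "1 / pochhammer (real a) k \<le> 1 / fact k"
    using assms(1) by (intro divide_left_mono fact_le_pochhammer mult_pos_pos pochhammer_pos) auto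
  ultimately have "1 / pochhammer (real a) k \<le> exp (1 / c) * c ^ k"
    by linarith
  then have "(z ^ k / fact k) * (1 / pochhammer (real a) k) \<le> (z ^ k / fact k) * (exp (1 / c) * c ^ k)"
    using assms(3) by (intro mult_left_mono) auto
  then show "z ^ k / (pochhammer (real a) k * fact k) \<le> exp (1 / c) * ((c * z) ^ k /\<^sub>R fact k)"
    by (simp add: power_mult_distrib divide_inverse mult_ac)
qed

text \<open>
  The product rule produces \<open>hyp0F1 (a + 1)\<close> and \<open>hyp0F1 (a + 2)\<close>, which the contiguous relation
  collapses to \<open>hyp0F1 a\<close>. This is what makes integration by parts close up for integrands whose
  power of \<open>t\<close> is one below the parameter.
\<close>

lemma DERIV_power_hyp0F1:
  assumes "a > 0"
  shows "((\<lambda>t. t ^ a * hyp0F1 (a + 1) (t * y)) has_real_derivative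
      real a * t ^ (a - 1) * hyp0F1 a (t * y)) (at t)"
proof -
  have *: "t * t ^ (a - 1) = t ^ a"
    using assms by (cases a) auto
  have "((\<lambda>t. t ^ a * hyp0F1 (a + 1) (t * y)) has_real_derivative
      real a * t ^ (a - 1) * hyp0F1 (a + 1) (t * y)
        + t ^ a * (y * (hyp0F1 (a + 2) (t * y) / (real a + 1)))) (at t)"
    by (auto intro!: derivative_eq_intros simp: mult_ac add.commute)
  also have "real a * t ^ (a - 1) * hyp0F1 (a + 1) (t * y)
        + t ^ a * (y * (hyp0F1 (a + 2) (t * y) / (real a + 1)))
      = real a * t ^ (a - 1) * hyp0F1 a (t * y)"
  proof -
    have c: "real a * hyp0F1 a (t * y)
        = real a * hyp0F1 (a + 1) (t * y) + t * (y * (hyp0F1 (a + 2) (t * y) / (real a + 1)))"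
    proof -
      have "real a * (t * y / (real a * b) * F) = t * (y * (F / b))" for b F
        using assms by simp
      then show ?thesis
        unfolding hyp0F1_contiguous[OF assms] distrib_left[of "real a" "hyp0F1 (a + 1) (t * y)"]
        by simp
    qed
    have "real a * t ^ (a - 1) * hyp0F1 a (t * y) = t ^ (a - 1) * (real a * hyp0F1 a (t * y))"
      by simp
    then show ?thesis
      unfolding c *[symmetric] by (simp add: algebra_simps)
  qed
  finally show ?thesis .
qed

section \<open>The incomplete integrals\<close>

lemma H_integrand_integrable:
  assumes "a > 0"
  shows "(\<lambda>t. t ^ k * exp (- t) * hyp0F1 a (t * y)) integrable_on {0..x}"
  using assms by (intro integrable_continuous_real continuous_intros)

text \<open>
  Integration by parts: both sides come from integrating the derivative of
  \<open>exp (- t) * t ^ a * hyp0F1 (a + 1) (t * y)\<close> over \<open>[0, x]\<close>.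
\<close>

lemma H_recurrence:
  assumes "a > 0" "0 \<le> x"
  shows "H a (a + 1) x y = real a * H (a - 1) a x y - x ^ a * exp (- x) * hyp0F1 (a + 1) (x * y)"
proof -
  let ?f = "\<lambda>t. real a * (t ^ (a - 1) * exp (- t) * hyp0F1 a (t * y))
                 - t ^ a * exp (- t) * hyp0F1 (a + 1) (t * y)"
  have "((\<lambda>t. exp (- t) * (t ^ a * hyp0F1 (a + 1) (t * y))) has_vector_derivative ?f t)
      (at t within {0..x})" for t
    unfolding has_real_derivative_iff_has_vector_derivative[symmetric]
  proof (rule has_field_derivative_at_within)
    have "((\<lambda>t. exp (- t)) has_real_derivative - exp (- t)) (at t)"
      by (auto intro!: derivative_eq_intros)
    from DERIV_mult[OF this DERIV_power_hyp0F1[OF assms(1)]]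
    show "((\<lambda>t. exp (- t) * (t ^ a * hyp0F1 (a + 1) (t * y))) has_real_derivative ?f t) (at t)"
      by (rule DERIV_cong) (simp add: algebra_simps)
  qed
  then have "(?f has_integral exp (- x) * (x ^ a * hyp0F1 (a + 1) (x * y))
      - exp (- 0) * (0 ^ a * hyp0F1 (a + 1) (0 * y))) {0..x}"
    using assms(2) by (intro fundamental_theorem_of_calculus) auto
  moreover have "(?f has_integral real a * H (a - 1) a x y - H a (a + 1) x y) {0..x}"
    unfolding H_def using assms(1)
    by (intro has_integral_diff has_integral_mult_right integrable_integral H_integrand_integrable) auto
  ultimately have "real a * H (a - 1) a x y - H a (a + 1) x y
      = exp (- x) * (x ^ a * hyp0F1 (a + 1) (x * y)) - exp (- 0) * (0 ^ a * hyp0F1 (a + 1) (0 * y))"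
    using has_integral_unique by blast
  then show ?thesis
    using assms(1) by (simp add: zero_power algebra_simps)
qed

lemma H_contiguous:
  assumes "a > 0"
  shows "H k a x y = H k (a + 1) x y + y / (real a * (real a + 1)) * H (k + 1) (a + 2) x y"
proof -
  have "((\<lambda>t. t ^ k * exp (- t) * hyp0F1 (a + 1) (t * y)
      + y / (real a * (real a + 1)) * (t ^ (k + 1) * exp (- t) * hyp0F1 (a + 2) (t * y)))
      has_integral H k (a + 1) x y + y / (real a * (real a + 1)) * H (k + 1) (a + 2) x y) {0..x}"
    unfolding H_def
    by (intro has_integral_add has_integral_mult_right integrable_integral H_integrand_integrable) auto
  also have "(\<lambda>t. t ^ k * exp (- t) * hyp0F1 (a + 1) (t * y)
      + y / (real a * (real a + 1)) * (t ^ (k + 1) * exp (- t) * hyp0F1 (a + 2) (t * y)))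
      = (\<lambda>t. t ^ k * exp (- t) * hyp0F1 a (t * y))"
    unfolding hyp0F1_contiguous[OF assms] by (simp add: fun_eq_iff algebra_simps)
  finally show ?thesis
    unfolding H_def[of k a] by (rule integral_unique)
qed

lemma DERIV_H_parameter:
  assumes "a > 0"
  shows "(H k a x has_real_derivative H (k + 1) (a + 1) x y / real a) (at y)"
proof -
  let ?f = "\<lambda>y t. t ^ k * exp (- t) * hyp0F1 a (t * y)"
  let ?f' = "\<lambda>y t. t ^ (k + 1) * exp (- t) * hyp0F1 (a + 1) (t * y) / real a"
  have "((\<lambda>y. integral (cbox 0 x) (?f y)) has_real_derivative integral (cbox 0 x) (?f' y))
      (at y within UNIV)"
  proof (rule leibniz_rule_field_derivative)
    show "((\<lambda>y. ?f y t) has_real_derivative ?f' y t) (at y within UNIV)" for y t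
      using assms by (auto intro!: derivative_eq_intros)
    show "?f y integrable_on cbox 0 x" for y
      using H_integrand_integrable[OF assms] by simp
    show "continuous_on (UNIV \<times> cbox 0 x) (\<lambda>(y, t). ?f' y t)"
      unfolding split_beta using assms by (intro continuous_intros) auto
  qed auto
  moreover have "H k a x = (\<lambda>y. integral (cbox 0 x) (?f y))"
    by (simp add: H_def fun_eq_iff)
  ultimately show ?thesis
    by (simp add: H_def)
qed

lemma DERIV_H_upper:
  assumes "a > 0" "0 < x"
  shows "((\<lambda>u. H k a u y) has_real_derivative x ^ k * exp (- x) * hyp0F1 a (x * y)) (at x)"
proof -
  let ?f = "\<lambda>t. t ^ k * exp (- t) * hyp0F1 a (t * y)"
  have "((\<lambda>u. integral {0..u} ?f) has_real_derivative ?f x) (at x within {0..x + 1})"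
    using assms by (intro integral_has_real_derivative continuous_intros) auto
  moreover have "at x within {0..x + 1} = at x"
    using assms by (intro at_within_Icc_at) auto
  ultimately show ?thesis
    by (simp add: H_def)
qed

text \<open>
  On \<open>[0, x]\<close> the factor \<open>hyp0F1 a (t * s)\<close> grows at most like \<open>exp (s / 2)\<close>, by the bound of
  exponential type \<open>1 / (2 x)\<close>.
\<close>

lemma exp_times_H_tendsto_0:
  assumes "a > 0" "0 < x"
  shows "((\<lambda>s. exp (- s) * H k a x s) \<longlongrightarrow> 0) at_top"
proof -
  define c where "c = 1 / (2 * x)"
  have c: "c > 0" "c * x = 1 / 2"
    using assms by (auto simp: c_def)
  define C where "C = x ^ k * exp (1 / c) * x"
  show ?thesis
  proof (rule tendsto_sandwich)
    show "((\<lambda>s::real. 0::real) \<longlongrightarrow> 0) at_top"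
      by simp
    have "((\<lambda>s::real. exp (- (s * (1/2)))) \<longlongrightarrow> 0) at_top"
      by (intro filterlim_compose[OF exp_at_bot] filterlim_uminus_at_bot_at_top[THEN filterlim_compose]
          filterlim_at_top_mult_tendsto_pos[OF tendsto_const] filterlim_ident) auto
    then show "((\<lambda>s. C * exp (- (s * (1/2)))) \<longlongrightarrow> 0) at_top"
      by (rule tendsto_mult_right_zero)
    show "\<forall>\<^sub>F s in at_top. 0 \<le> exp (- s) * H k a x s"
      unfolding H_def using eventually_ge_at_top[of 0]
      by eventually_elim (use assms in \<open>auto intro!: mult_nonneg_nonneg integral_nonneg
          H_integrand_integrable hyp0F1_nonneg\<close>)
    show "\<forall>\<^sub>F s in at_top. exp (- s) * H k a x s \<le> C * exp (- (s * (1/2)))"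
      using eventually_ge_at_top[of 0]
    proof eventually_elim
      case (elim s)
      have "H k a x s \<le> integral {0..x} (\<lambda>t. x ^ k * (exp (1 / c) * exp (s / 2)))"
        unfolding H_def
      proof (intro integral_le H_integrand_integrable assms)
        fix t assume t: "t \<in> {0..x}"
        have "hyp0F1 a (t * s) \<le> exp (1 / c) * exp (c * (t * s))"
          using assms c t elim by (intro hyp0F1_le_exp) auto
        also have "c * (t * s) \<le> c * (x * s)"
          using c t elim by (intro mult_left_mono mult_right_mono) auto
        also have "c * (x * s) = s / 2"
          using c(2) by (simp flip: mult.assoc)
        finally have "hyp0F1 a (t * s) \<le> exp (1 / c) * exp (s / 2)"
          by simp
        moreover have "t ^ k * exp (- t) \<le> x ^ k * 1"
          using t by (intro mult_mono power_mono) auto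
        moreover have "0 \<le> hyp0F1 a (t * s)"
          using assms t elim by (intro hyp0F1_nonneg) auto
        ultimately show "t ^ k * exp (- t) * hyp0F1 a (t * s) \<le> x ^ k * (exp (1 / c) * exp (s / 2))"
          using t assms by (intro mult_mono) auto
      qed auto
      also have "\<dots> = C * exp (s / 2)"
        using assms by (simp add: C_def)
      finally have "exp (- s) * H k a x s \<le> exp (- s) * (C * exp (s / 2))"
        by (intro mult_left_mono) auto
      also have "\<dots> = C * (exp (- s) * exp (s / 2))"
        by simp
      also have "exp (- s) * exp (s / 2) = exp (- (s * (1/2)))"
        by (simp flip: exp_add)
      finally show ?case .
    qed
  qed
qed

section \<open>Exchanging the finite and the infinite integral\<close>

text \<open>
  The right side is minus an antiderivative of the integrand on the left, as a function of \<open>y\<close>: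
  differentiating under the integral sign raises \<open>H (a - 1) a\<close> to \<open>H a (a + 1) / a\<close>, and the
  recurrence leaves only the boundary term of the integration by parts.
\<close>

lemma integral_Ici_exp_hyp0F1:
  assumes "a > 0" "0 < x" "0 \<le> y"
  shows "integral {y..} (\<lambda>s. exp (- s) * hyp0F1 (a + 1) (x * s))
    = real a * exp x / x ^ a * (exp (- y) * H (a - 1) a x y)"
proof -
  define P where "P s = - (real a * exp x / x ^ a) * (exp (- s) * H (a - 1) a x s)" for s
  let ?f = "\<lambda>s. exp (- s) * hyp0F1 (a + 1) (x * s)"
  have P': "(P has_real_derivative ?f s) (at s)" for s
  proof -
    have rec: "H a (a + 1) x s = real a * H (a - 1) a x s - x ^ a * exp (- x) * hyp0F1 (a + 1) (x * s)"
      using assms by (intro H_recurrence) auto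
    have "(H (a - 1) a x has_real_derivative H a (a + 1) x s / real a) (at s)"
      using DERIV_H_parameter[OF assms(1), of "a - 1" x s] assms(1) by simp
    then have "(P has_real_derivative - (real a * exp x / x ^ a) *
        (exp (- s) * (H a (a + 1) x s / real a) - exp (- s) * H (a - 1) a x s)) (at s)"
      unfolding P_def by (intro DERIV_cmult) (auto intro!: derivative_eq_intros)
    moreover have "- (real a * exp x / x ^ a) *
        (exp (- s) * (H a (a + 1) x s / real a) - exp (- s) * H (a - 1) a x s)
        = (exp x * exp (- x)) * ?f s"
      unfolding rec using assms by (simp add: field_simps del: mult_exp_exp)
    ultimately show ?thesis
      by (simp flip: exp_add)
  qed
  have FTC: "(?f has_integral (P z - P y)) {y..z}" if "y \<le> z" for z
    using that P'
    by (intro fundamental_theorem_of_calculus)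
       (auto simp flip: has_real_derivative_iff_has_vector_derivative intro: has_field_derivative_at_within)
  have "(P \<longlongrightarrow> 0) at_top"
    unfolding P_def using assms by (intro tendsto_mult_right_zero exp_times_H_tendsto_0) auto
  then have "((\<lambda>z. P z - P y) \<longlongrightarrow> 0 - P y) at_top"
    by (intro tendsto_diff tendsto_const)
  then have "((\<lambda>z. integral {y..z} ?f) \<longlongrightarrow> 0 - P y) at_top"
  proof (rule Lim_transform_eventually[where f = "\<lambda>z. P z - P y"])
    show "\<forall>\<^sub>F z in at_top. P z - P y = integral {y..z} ?f"
      using eventually_ge_at_top[of y] by eventually_elim (rule integral_unique[OF FTC, symmetric])
  qed
  then have "(?f has_integral 0 - P y) {y..}"
    using assms
    by (intro has_integral_to_inf integrable_continuous_real continuous_intros)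
       (auto intro!: mult_nonneg_nonneg hyp0F1_nonneg)
  then show ?thesis
    by (simp add: integral_unique P_def)
qed

section \<open>The density\<close>

text \<open>
  The left side equals the integral of \<open>(x - t) * t ^ (n - 2) * exp (- t) * hyp0F1 (n - 1) (t * y)\<close>
  over \<open>[0, x]\<close>, which is what the derivative of the determinant leaves in each column.
\<close>

lemma H_combination_eq_G2:
  assumes "n \<ge> 2" "0 < x" "0 \<le> y"
  shows "x * H (n - 2) (n - 1) x y - H (n - 1) (n - 1) x y
    = x ^ n * exp (- x) / (real n * (real n - 1)) * G2 n x y"
proof -
  obtain m where n: "n = m + 2"
    using assms(1) by (metis add.commute le_Suc_ex)
  \<comment> \<open>Kept opaque so that the simplifier treats the exponential as a coefficient.\<close>
  define e where "e = exp (- x)"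
  define K where "K = H (m + 1) (m + 2) x y"
  have J: "integral {y..} (\<lambda>t. exp (- t) * hyp0F1 (n + 1) (x * t))
      = (real m + 2) / (e * x ^ (m + 2)) * (exp (- y) * K)"
    using integral_Ici_exp_hyp0F1[of "m + 2" x y] assms
    by (simp add: n K_def e_def exp_minus field_simps)
  have r1: "K = (real m + 1) * H m (m + 1) x y - x ^ (m + 1) * e * hyp0F1 (m + 2) (x * y)"
    using H_recurrence[of "m + 1" x y] assms by (simp add: K_def e_def)
  have r2: "H (m + 2) (m + 3) x y = (real m + 2) * K - x ^ (m + 2) * e * hyp0F1 (m + 3) (x * y)"
    using H_recurrence[of "m + 2" x y] assms by (simp add: K_def e_def numeral_3_eq_3)
  have r3: "H (m + 1) (m + 1) x y = K + y / ((real m + 1) * (real m + 2)) * H (m + 2) (m + 3) x y"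
    using H_contiguous[of "m + 1" "m + 1" x y] by (simp add: K_def numeral_3_eq_3 add_ac)
  have E: "exp y * (c * (exp (- y) * K)) = c * K" for c
    by (simp add: exp_minus)
  have G: "G2 n x y = (real m + 2) * hyp0F1 (m + 2) (x * y) + y * hyp0F1 (m + 3) (x * y)
      + (x - y - real m - 1) * ((real m + 2) / (e * x ^ (m + 2)) * K)"
    unfolding G2_def J mult.assoc E by (simp add: n algebra_simps numeral_3_eq_3)
  have M: "H m (m + 1) x y = (K + x ^ (m + 1) * e * hyp0F1 (m + 2) (x * y)) / (real m + 1)"
    using r1 by (simp add: field_simps)
  have e: "e > 0" by (simp add: e_def)
  have "x * H m (m + 1) x y - H (m + 1) (m + 1) x y
      = x ^ (m + 2) * e / ((real m + 2) * (real m + 1)) * G2 n x y"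
  proof -
    \<comment> \<open>The identity is polynomial in \<open>p\<close> and \<open>q\<close> separately; their relation would only hinder
      clearing denominators.\<close>
    define p where "p = real m + 1"
    define q where "q = real m + 2"
    have pq: "p > 0" "q > 0" "real m = p - 1" by (auto simp: p_def q_def)
    show ?thesis
      unfolding G r3 r2 M p_def[symmetric] q_def[symmetric]
      unfolding pq(3)
      using pq(1,2) e assms(2) by (simp add: field_simps)
  qed
  then show ?thesis
    by (simp add: n e_def algebra_simps)
qed

theorem mainTheorem4:
  fixes n :: nat and x l1 l2 :: real
  assumes "n \<ge> 2" and "x > 0" and "l1 \<ge> 0" and "l2 \<ge> 0" and "l1 \<noteq> l2"
  shows "psi2 n x l1 l2 =
    x ^ (2 * n - 2) * exp (- l1 - l2 - 2 * x) / (fact n * fact (n - 2) * (l1 - l2)) *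
    det (vector
      [vector [hyp0F1 (n - 1) (x * l1), hyp0F1 (n - 1) (x * l2)],
       vector [G2 n x l1, G2 n x l2]] :: real ^ 2 ^ 2)"
proof -
  define A where "A l u = H (n - 1) (n - 1) u l" for l u
  define B where "B l u = H (n - 2) (n - 1) u l" for l u
  define F where "F l = hyp0F1 (n - 1) (x * l)" for l
  define w where "w = x ^ (n - 2) * exp (- x)"
  define c where "c = x ^ n * exp (- x) / (real n * (real n - 1))"
  have pow: "x ^ (n - 1) = x * x ^ (n - 2)"
    using assms(1) by (simp flip: power_Suc add: Suc_diff_Suc numeral_2_eq_2)
  have A': "(A l has_real_derivative x * w * F l) (at x)" for l
    using DERIV_H_upper[of "n - 1" x "n - 1" l] assms
    unfolding A_def F_def w_def pow by (simp add: mult.assoc)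
  have B': "(B l has_real_derivative w * F l) (at x)" for l
    using DERIV_H_upper[of "n - 1" x "n - 2" l] assms unfolding B_def F_def w_def by simp
  have D: "x * B l x - A l x = c * G2 n x l" if "l \<ge> 0" for l
    using H_combination_eq_G2[of n x l] assms that by (simp add: A_def B_def c_def)
  have "((\<lambda>u. A l1 u * B l2 u - A l2 u * B l1 u) has_real_derivative
      w * (F l1 * (x * B l2 x - A l2 x) - F l2 * (x * B l1 x - A l1 x))) (at x)"
    by (auto intro!: derivative_eq_intros A' B' simp: algebra_simps)
  then have "deriv (\<lambda>u. A l1 u * B l2 u - A l2 u * B l1 u) x
      = w * c * (F l1 * G2 n x l2 - F l2 * G2 n x l1)"
    using D[OF assms(3)] D[OF assms(4)]
    by (simp add: DERIV_imp_deriv algebra_simps)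
  then have "psi2 n x l1 l2 = exp (- l1 - l2) / ((fact (n - 2))\<^sup>2 * (l1 - l2)) *
      (w * c * (F l1 * G2 n x l2 - F l2 * G2 n x l1))"
    by (simp add: psi2_def det_2 A_def B_def)
  also have "\<dots> = (exp (- l1 - l2) / ((fact (n - 2))\<^sup>2 * (l1 - l2)) * (w * c))
      * (F l1 * G2 n x l2 - F l2 * G2 n x l1)"
    by simp
  also have "exp (- l1 - l2) / ((fact (n - 2))\<^sup>2 * (l1 - l2)) * (w * c)
      = x ^ (2 * n - 2) * exp (- l1 - l2 - 2 * x) / (fact n * fact (n - 2) * (l1 - l2))"
  proof -
    obtain m where n: "n = Suc (Suc m)"
      using assms(1) by (metis Suc_le_D numeral_2_eq_2 Suc_le_mono)
    have "exp (- l1 - l2 - 2 * x) = exp (- l1 - l2) * exp (- x) * exp (- x)"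
      by (simp flip: exp_add)
    moreover have "x ^ (2 * n - 2) = x ^ (n - 2) * x ^ n"
      using assms(1) by (simp add: mult_2 flip: power_add)
    moreover have "(fact n :: real) = real n * (real n - 1) * fact (n - 2)"
      by (simp add: n algebra_simps)
    ultimately show ?thesis
      by (simp add: w_def c_def power2_eq_square mult_ac)
  qed
  finally show ?thesis
    by (simp add: det_2 F_def mult.commute)
qed

end
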